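(* Let $n\in\mathbb{N}$ with $n\geq 2$, let $L$ and $M$ be distributive lattices, and let $T\colon L^n\to M$ be a symmetric lattice $n$-homomorphism with diagonal map $P_T\colon L\to M$, $P_T(x):=T(x,x,\dots,x)$. Then $P_T$ is a lattice homomorphism if and only if for all $x_1,\dots,x_n\in L$ we have $$\bigwedge_{i=1}^n P_T(x_i)\leq T(x_1,\dots,x_n)\leq\bigvee_{i=1}^n P_T(x_i).$$
   Context: A map $T\colon L^n\to M$ between lattices is a lattice $n$-homomorphism if it is a lattice homomorphism in each variable separately, i.e. for all $x_1,\dots,x_n,y\in L$ and $i\in\{1,\dots,n\}$, $T(x_1,\dots,x_{i-1},x_i\vee y,x_{i+1},\dots,x_n)=T(x_1,\dots,x_n)\vee T(x_1,\dots,x_{i-1},y,x_{i+1},\dots,x_n)$, and likewise with $\vee$ replaced by $\wedge$ throughout. $T$ is symmetric if its value is unchanged under every permutation of its arguments. A lattice homomorphism is a map preserving binary $\vee$ and $\wedge$. *)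

theory Defs
  imports Main "HOL-Library.Cardinality"
begin

text \<open>
  \<open>L\<^sup>n\<close> is the function type \<open>'n \<Rightarrow> 'a\<close> over a finite index type \<open>'n\<close> with \<open>CARD('n) = n\<close>;
  \<open>x(i := y)\<close> replaces the \<open>i\<close>-th argument \<open>x\<^sub>i\<close> of the tuple \<open>x\<close> by \<open>y\<close>.
\<close>

definition lattice_hom :: "('a::lattice \<Rightarrow> 'b::lattice) \<Rightarrow> bool" where
  "lattice_hom f \<longleftrightarrow>
     (\<forall>x y. f (sup x y) = sup (f x) (f y)) \<and>
     (\<forall>x y. f (inf x y) = inf (f x) (f y))"

definition lattice_n_hom :: "(('n::finite \<Rightarrow> 'a::lattice) \<Rightarrow> 'b::lattice) \<Rightarrow> bool" where
  "lattice_n_hom T \<longleftrightarrow>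
     (\<forall>x y i. T (x(i := sup (x i) y)) = sup (T x) (T (x(i := y)))) \<and>
     (\<forall>x y i. T (x(i := inf (x i) y)) = inf (T x) (T (x(i := y))))"

definition symmetric_map :: "(('n::finite \<Rightarrow> 'a) \<Rightarrow> 'b) \<Rightarrow> bool" where
  "symmetric_map T \<longleftrightarrow> (\<forall>\<pi> x. bij \<pi> \<longrightarrow> T (x \<circ> \<pi>) = T x)"

definition diagonal_map :: "(('n::finite \<Rightarrow> 'a) \<Rightarrow> 'b) \<Rightarrow> 'a \<Rightarrow> 'b" where
  "diagonal_map T x = T (\<lambda>_. x)"

end

theory Submission imports Defs begin

text \<open>
  An \<open>n\<close>-homomorphism \<open>T\<close> is monotone, so a homomorphic diagonal map \<open>P\<close> gives
  \<open>T x \<le> P (\<Squnion>i. x i) = (\<Squnion>i. P (x i))\<close>, and dually. Conversely, expanding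
  \<open>P (a \<squnion> b) = T (a \<squnion> b, \<dots>, a \<squnion> b)\<close> in every variable yields the join of all \<open>T z\<close> with
  entries \<open>z i \<in> {a, b}\<close>, each of which is at most \<open>P a \<squnion> P b\<close> by the assumed upper bound;
  the reverse inequality is monotonicity.
\<close>

lemma lattice_hom_Inf_fin:
  assumes "lattice_hom f" "finite A" "A \<noteq> {}"
  shows "f (Inf_fin A) = Inf_fin (f ` A)"
  using assms(2,3)
proof (induction A rule: finite_ne_induct)
  case (insert a A)
  then show ?case using assms(1) by (simp add: lattice_hom_def)
qed simp

lemma lattice_hom_Sup_fin:
  assumes "lattice_hom f" "finite A" "A \<noteq> {}"
  shows "f (Sup_fin A) = Sup_fin (f ` A)"
  using assms(2,3)
proof (induction A rule: finite_ne_induct)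
  case (insert a A)
  then show ?case using assms(1) by (simp add: lattice_hom_def)
qed simp

text \<open>This is the definition at the tuple \<open>z(i := a)\<close>, whose entry at
  \<open>i\<close> is \<open>a\<close>.\<close>

lemma lattice_n_hom_sup:
  assumes "lattice_n_hom T"
  shows "T (z(i := sup a b)) = sup (T (z(i := a))) (T (z(i := b)))"
  using assms unfolding lattice_n_hom_def by (metis fun_upd_same fun_upd_upd)

lemma lattice_n_hom_inf:
  assumes "lattice_n_hom T"
  shows "T (z(i := inf a b)) = inf (T (z(i := a))) (T (z(i := b)))"
  using assms unfolding lattice_n_hom_def by (metis fun_upd_same fun_upd_upd)

text \<open>Switch the coordinates from \<open>x\<close> to \<open>y\<close> one at a time. Each
  switch replaces an entry by its join with a larger one, so the old value of \<open>T\<close> is a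
  joinand of the new one.\<close>

lemma lattice_n_hom_mono:
  fixes T :: "('n::finite \<Rightarrow> 'a::lattice) \<Rightarrow> 'b::lattice"
  assumes T: "lattice_n_hom T" and le: "\<And>i. x i \<le> y i"
  shows "T x \<le> T y"
proof -
  have "T x \<le> T (override_on x y A)" if "finite A" for A
    using that
  proof (induction A)
    case empty
    then show ?case by simp
  next
    case (insert a A)
    let ?z = "override_on x y A"
    have "?z a = x a" using insert.hyps by simp
    then have "sup (?z a) (y a) = y a" using le[of a] by (simp add: sup_absorb2)
    then have "T (?z(a := y a)) = sup (T ?z) (T (?z(a := y a)))"
      using lattice_n_hom_sup[OF T, of ?z a "?z a" "y a"] by simp
    then have "T ?z \<le> T (override_on x y (insert a A))"
      by (metis override_on_insert sup_ge1)
    with insert.IH show ?case by (rule order_trans)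
  qed
  from this[of UNIV] show ?thesis by (simp add: override_on_def)
qed

text \<open>Packages the multilinear expansion: used with \<open>c\<close> the join or meet of
  \<open>a\<close> and \<open>b\<close>, and with \<open>Q\<close> a bound on \<open>T\<close> that
  survives joins or meets of values.\<close>

lemma constant_tuple_induct:
  fixes Q :: "('n::finite \<Rightarrow> 'a) \<Rightarrow> bool"
  assumes base: "\<And>z. range z \<subseteq> {a, b} \<Longrightarrow> Q z"
    and step: "\<And>z i. Q (z(i := a)) \<Longrightarrow> Q (z(i := b)) \<Longrightarrow> Q (z(i := c))"
  shows "Q (\<lambda>_. c)"
proof -
  \<comment> \<open>Generalised for induction: \<open>A\<close> holds the coordinates not yet
    expanded, and those outside it already carry \<open>a\<close> or \<open>b\<close>.\<close>
  have "Q z" if "finite A" "\<And>i. i \<in> A \<Longrightarrow> z i = c" "\<And>i. i \<notin> A \<Longrightarrow> z i \<in> {a, b}" for A z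
    using that
  proof (induction A arbitrary: z)
    case empty
    then show ?case by (intro base) blast
  next
    case (insert j A)
    have "Q (z(j := d))" if "d \<in> {a, b}" for d
      using insert.prems insert.hyps that by (intro insert.IH) (simp_all, blast+)
    then have "Q (z(j := c))" by (intro step) auto
    moreover have "z j = c" using insert.prems(1) by simp
    ultimately show ?case by (metis fun_upd_triv)
  qed
  from this[of UNIV "\<lambda>_. c"] show ?thesis by simp
qed

theorem lemma4p5:
  fixes T :: "('n::finite \<Rightarrow> 'a::distrib_lattice) \<Rightarrow> 'b::distrib_lattice"
  assumes "CARD('n) \<ge> 2"
    and "lattice_n_hom T"
    and "symmetric_map T"
  shows "lattice_hom (diagonal_map T) \<longleftrightarrow>
    (\<forall>x :: 'n \<Rightarrow> 'a.
       Inf_fin ((\<lambda>i. diagonal_map T (x i)) ` UNIV) \<le> T x \<and>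
       T x \<le> Sup_fin ((\<lambda>i. diagonal_map T (x i)) ` UNIV))"
proof (intro iffI allI conjI)
  let ?P = "diagonal_map T"
  note T = assms(2)
  fix x :: "'n \<Rightarrow> 'a"
  assume hom: "lattice_hom ?P"
  have "Inf_fin (range (\<lambda>i. ?P (x i))) = ?P (Inf_fin (range x))"
    using hom by (simp add: lattice_hom_Inf_fin image_image)
  also have "\<dots> \<le> T x"
    unfolding diagonal_map_def by (rule lattice_n_hom_mono[OF T]) (simp add: Inf_fin.coboundedI)
  finally show "Inf_fin (range (\<lambda>i. ?P (x i))) \<le> T x" .
  have "T x \<le> ?P (Sup_fin (range x))"
    unfolding diagonal_map_def by (rule lattice_n_hom_mono[OF T]) (simp add: Sup_fin.coboundedI)
  also have "\<dots> = Sup_fin (range (\<lambda>i. ?P (x i)))"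
    using hom by (simp add: lattice_hom_Sup_fin image_image)
  finally show "T x \<le> Sup_fin (range (\<lambda>i. ?P (x i)))" .
next
  let ?P = "diagonal_map T"
  note T = assms(2)
  assume bounds: "\<forall>x. Inf_fin (range (\<lambda>i. ?P (x i))) \<le> T x \<and>
    T x \<le> Sup_fin (range (\<lambda>i. ?P (x i)))"
  have mono: "?P a \<le> ?P b" if "a \<le> b" for a b
    unfolding diagonal_map_def using that by (intro lattice_n_hom_mono[OF T])
  have "?P (sup a b) \<le> sup (?P a) (?P b)" for a b
    \<comment> \<open>Only the left side is unfolded, so the bound on the right stays fixed during
      the expansion.\<close>
    unfolding diagonal_map_def[of T "sup a b"]
  proof (rule constant_tuple_induct[where a = a and b = b
        and Q = "\<lambda>z. T z \<le> sup (?P a) (?P b)"])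
    fix z :: "'n \<Rightarrow> 'a"
    assume "range z \<subseteq> {a, b}"
    then have "z i = a \<or> z i = b" for i by blast
    then have "?P (z i) \<le> sup (?P a) (?P b)" for i
      by (metis sup_ge1 sup_ge2)
    then have "Sup_fin (range (\<lambda>i. ?P (z i))) \<le> sup (?P a) (?P b)"
      by (intro Sup_fin.boundedI) auto
    with bounds show "T z \<le> sup (?P a) (?P b)" by (meson order_trans)
  \<comment> \<open>Expanding one coordinate gives a join of two values, both below the
    bound.\<close>
  qed (simp add: lattice_n_hom_sup[OF T])
  moreover have "inf (?P a) (?P b) \<le> ?P (inf a b)" for a b
    unfolding diagonal_map_def[of T "inf a b"]
  proof (rule constant_tuple_induct[where a = a and b = b
        and Q = "\<lambda>z. inf (?P a) (?P b) \<le> T z"])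
    fix z :: "'n \<Rightarrow> 'a"
    assume "range z \<subseteq> {a, b}"
    then have "z i = a \<or> z i = b" for i by blast
    then have "inf (?P a) (?P b) \<le> ?P (z i)" for i
      by (metis inf_le1 inf_le2)
    then have "inf (?P a) (?P b) \<le> Inf_fin (range (\<lambda>i. ?P (z i)))"
      by (intro Inf_fin.boundedI) auto
    with bounds show "inf (?P a) (?P b) \<le> T z" by (meson order_trans)
  qed (simp add: lattice_n_hom_inf[OF T])
  \<comment> \<open>The two opposite inequalities hold for any monotone map.\<close>
  ultimately show "lattice_hom ?P"
    unfolding lattice_hom_def by (auto intro!: antisym mono)
qed

end
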